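(* Let $\lambda$ be an uncountable cardinal. If the very weak diamond $\Psi_\lambda$ holds, then $2^{<\lambda}<2^\lambda$.
   Context: For an uncountable cardinal $\lambda$, the very weak diamond $\Psi_\lambda$ is the statement: for every function $c:{}^{<\lambda}2\to 2$ there exists a function $g\in{}^{\lambda}2$ such that for every $f\in{}^{\lambda}2$ the set $\{\alpha<\lambda : c(f\upharpoonright\alpha)=g(\alpha)\}$ is unbounded in $\lambda$. Here ${}^{<\lambda}2=\bigcup_{\alpha<\lambda}{}^{\alpha}2$ is the set of all functions from some ordinal $\alpha<\lambda$ into $2=\{0,1\}$. *)

theory Defs
  imports Main "HOL-Library.Countable_Set"
begin

unbundle cardinal_syntax

text \<open>
  A cardinal \<open>\<lambda>\<close> is a relation \<open>r\<close> with \<^term>\<open>Card_order r\<close>, i.e. a well-order of \<open>Field r\<close>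
  of least possible order type. For infinite \<open>\<lambda>\<close> (a limit ordinal), the ordinals \<open>\<alpha> < \<lambda>\<close>
  correspond to the elements \<open>a\<close> of \<open>Field r\<close>, the set of ordinals below \<open>\<alpha>\<close> being
  \<open>underS r a\<close>.

  A function from a set \<open>A\<close> into \<open>2\<close> is a partial map into \<^typ>\<open>bool\<close> with domain exactly \<open>A\<close>.
  Partial maps keep track of the domain, so that functions on different ordinals are different;
  extensional total functions into \<^typ>\<open>bool\<close> would identify some of them.
\<close>

definition fun2 :: "'a set \<Rightarrow> ('a \<rightharpoonup> bool) set" where
  "fun2 A = {f. dom f = A}"

definition fun2_less :: "'a rel \<Rightarrow> ('a \<rightharpoonup> bool) set" where
  "fun2_less r = (\<Union>a \<in> Field r. fun2 (underS r a))"

text \<open>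
  The values of \<open>c\<close> outside \<open>fun2_less r\<close> are never used. For a limit ordinal, being unbounded
  is the same as being \<^const>\<open>cofinal\<close>, which asks for strictly larger elements.
\<close>

definition very_weak_diamond :: "'a rel \<Rightarrow> bool" where
  "very_weak_diamond r \<longleftrightarrow>
     (\<forall>c :: ('a \<rightharpoonup> bool) \<Rightarrow> bool.
        \<exists>g \<in> fun2 (Field r). \<forall>f \<in> fun2 (Field r).
          cofinal {a \<in> Field r. Some (c (f |` underS r a)) = g a} r)"

text \<open>
  The cardinal \<open>2^(<\<lambda>)\<close> is the cardinality of the set of functions from some \<open>\<alpha> < \<lambda>\<close> into \<open>2\<close>.
\<close>

definition ctwo_less :: "'a rel \<Rightarrow> ('a \<rightharpoonup> bool) rel" where
  "ctwo_less r = |fun2_less r|"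

end

theory Submission
  imports Defs
begin

text \<open>
  If \<open>2^\<lambda> \<le> 2^(<\<lambda>)\<close>, then the subsets of \<open>\<lambda>\<close> are coded injectively by functions \<open>h\<close> on ordinals
  \<open>\<alpha> < \<lambda>\<close>. Prolong \<open>h\<close> to \<open>f \<in> \<^sup>\<lambda>2\<close> by the value \<open>1\<close> at \<open>\<alpha>\<close> and \<open>0\<close> above. From every \<open>f \<restriction> \<beta>\<close> with
  \<open>\<beta> > \<alpha>\<close> one recovers \<open>\<alpha>\<close>, as the largest place where the value is \<open>1\<close>, hence \<open>h\<close> and the subset
  coded by \<open>h\<close>. So a single \<open>c\<close> can disagree with any \<open>g\<close> at all large \<open>\<beta>\<close>, along the \<open>f\<close> obtained
  from the code of \<open>g\<close>, against the very weak diamond.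
\<close>

text \<open>The domain of a restriction thus determines the place where it was cut, as decoding by
  \<open>avoid\<close> requires.\<close>

lemma underS_inject:
  assumes "Linear_order r" "a \<in> Field r" "b \<in> Field r" "underS r a = underS r b"
  shows "a = b"
proof (rule ccontr)
  assume "a \<noteq> b"
  then have "a \<in> underS r b \<or> b \<in> underS r a"
    using assms by (auto simp: underS_def order_on_defs total_on_def)
  then show False
    using assms(4) by (auto simp: underS_def)
qed

definition prolong :: "'a rel \<Rightarrow> 'a \<Rightarrow> ('a \<rightharpoonup> bool) \<Rightarrow> ('a \<rightharpoonup> bool)" where
  "prolong r a h = (\<lambda>x. if x \<in> underS r a then h x
     else if x \<in> Field r then Some (x = a) else None)"

lemma prolong_in_fun2:
  assumes "h \<in> fun2 (underS r a)"
  shows "prolong r a h \<in> fun2 (Field r)"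
  using assms underS_Field[of _ r a]
  by (auto simp: fun2_def prolong_def dom_def split: if_splits)

lemma prolong_restrict:
  assumes "h \<in> fun2 (underS r a)"
  shows "prolong r a h |` underS r a = h"
proof -
  have "h x = None" if "x \<notin> underS r a" for x
    using assms that by (auto simp: fun2_def domIff[symmetric])
  then show ?thesis
    by (auto simp: prolong_def restrict_map_def fun_eq_iff)
qed

lemma prolong_self: "a \<in> Field r \<Longrightarrow> prolong r a h a = Some True"
  by (simp add: prolong_def underS_def)

lemma prolong_True_le:
  assumes "Refl r" "prolong r a h x = Some True"
  shows "(x, a) \<in> r"
  using assms by (auto simp: prolong_def underS_def refl_on_def split: if_splits)

text \<open>
  Here \<open>F\<close> decodes initial segments into subsets of \<open>\<lambda>\<close>; on \<open>f \<restriction> \<beta>\<close>, the predicate asks whether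
  \<open>\<beta>\<close> is missing from the decoded set.
\<close>

definition avoid :: "'a rel \<Rightarrow> (('a \<rightharpoonup> bool) \<Rightarrow> 'a set) \<Rightarrow> ('a \<rightharpoonup> bool) \<Rightarrow> bool" where
  "avoid r F p \<longleftrightarrow> (\<exists>a b. b \<in> Field r \<and> dom p = underS r b \<and> p a = Some True
     \<and> (\<forall>x. p x = Some True \<longrightarrow> (x, a) \<in> r) \<and> b \<notin> F (p |` underS r a))"

lemma avoid_prolong:
  assumes "Well_order r" "h \<in> fun2 (underS r a)" "a \<in> underS r b"
  shows "avoid r F (prolong r a h |` underS r b) \<longleftrightarrow> b \<notin> F h"
proof -
  let ?p = "prolong r a h |` underS r b"
  have lin: "Linear_order r" and refl: "Refl r" and trans: "trans r" and anti: "antisym r"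
    using assms(1) by (auto simp: order_on_defs)
  have a: "a \<in> Field r" and b: "b \<in> Field r" and ab: "(a, b) \<in> r"
    using assms(3) by (auto simp: underS_def Field_def)
  have dom: "dom ?p = underS r b"
    using prolong_in_fun2[OF assms(2)] underS_Field[of _ r b] by (auto simp: fun2_def)
  have pa: "?p a = Some True"
    using assms(3) prolong_self[OF a] by simp
  have max: "(x, a) \<in> r" if "?p x = Some True" for x
    using that prolong_True_le[OF refl] by (auto simp: restrict_map_def split: if_splits)
  have "underS r a \<subseteq> underS r b"
    using underS_incr[OF trans anti ab] .
  then have restr: "?p |` underS r a = h"
    using prolong_restrict[OF assms(2)] by (simp add: Int_absorb1)
  \<comment> \<open>Both witnesses in \<open>avoid\<close> are unique: \<open>b\<close> by the
    domain, \<open>a\<close> as the largest place of value \<open>True\<close>.\<close>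
  have "b' = b" if "b' \<in> Field r" "dom ?p = underS r b'" for b'
    using underS_inject[OF lin that(1) b] that(2) dom by simp
  moreover have "a' = a" if "?p a' = Some True" "\<forall>x. ?p x = Some True \<longrightarrow> (x, a') \<in> r" for a'
    using antisymD[OF anti max[OF that(1)]] that(2) pa by simp
  ultimately have "avoid r F ?p \<longleftrightarrow> b \<notin> F (?p |` underS r a)"
    unfolding avoid_def using b dom pa max by blast
  then show ?thesis
    by (simp only: restr)
qed

lemma not_very_weak_diamond_if_Pow_le:
  assumes "Well_order r" "|Pow (Field r)| \<le>o |fun2_less r|"
  shows "\<not> very_weak_diamond r"
proof
  assume "very_weak_diamond r"
  obtain G where inj: "inj_on G (Pow (Field r))" and G: "G ` Pow (Field r) \<subseteq> fun2_less r"
    using assms(2) unfolding card_of_ordLeq[symmetric] by blast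
  let ?F = "inv_into (Pow (Field r)) G"
  obtain g where g: "g \<in> fun2 (Field r)" and cof: "\<And>f. f \<in> fun2 (Field r) \<Longrightarrow>
      cofinal {b \<in> Field r. Some (avoid r ?F (f |` underS r b)) = g b} r"
    using \<open>very_weak_diamond r\<close>[unfolded very_weak_diamond_def, rule_format, of "avoid r ?F"]
    by blast
  \<comment> \<open>On \<open>Field r\<close>, membership in \<open>?S\<close> is the value of
    \<open>g\<close>, so \<open>b \<notin> ?S\<close> is its negation.\<close>
  let ?S = "{x \<in> Field r. g x = Some True}"
  have "G ?S \<in> fun2_less r"
    using G by (simp add: image_subset_iff)
  then obtain a where a: "a \<in> Field r" "G ?S \<in> fun2 (underS r a)"
    by (auto simp: fun2_less_def)
  \<comment> \<open>Being strictly above \<open>a\<close>, such a \<open>b\<close> keeps the mark at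
    \<open>a\<close> inside the restriction to \<open>underS r b\<close>.\<close>
  obtain b where b: "a \<noteq> b" "(a, b) \<in> r" "b \<in> Field r"
      "Some (avoid r ?F (prolong r a (G ?S) |` underS r b)) = g b"
    using cof[OF prolong_in_fun2[OF a(2)], unfolded cofinal_def, rule_format, OF a(1)] by blast
  have "avoid r ?F (prolong r a (G ?S) |` underS r b) \<longleftrightarrow> b \<notin> ?F (G ?S)"
    using avoid_prolong[OF assms(1) a(2)] b by (simp add: underS_def)
  also have "?F (G ?S) = ?S"
    using inj by (intro inv_into_f_f) auto
  finally show False
    using b(3,4) by (cases "g b") auto
qed

theorem theorem2p1:
  fixes r :: "'a rel"
  assumes "Card_order r"
    and "uncountable (Field r)"
    and "very_weak_diamond r"
  shows "ctwo_less r <o ctwo ^c r"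
proof -
  have "\<not> |Pow (Field r)| \<le>o |fun2_less r|"
    using not_very_weak_diamond_if_Pow_le[OF card_order_on_well_order_on[OF assms(1)]] assms(3)
    by blast
  then have "|fun2_less r| <o |Pow (Field r)|"
    by (simp add: not_ordLeq_iff_ordLess[OF card_of_Well_order card_of_Well_order])
  also have "|Pow (Field r)| =o ctwo ^c r"
    using card_of_Pow_Func by (simp add: cexp_def ctwo_def Field_card_of)
  finally show ?thesis
    by (simp add: ctwo_less_def)
qed

end
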